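(* Let $X$ be a topological module over a topological ring $R$. Suppose a net $(\sigma_\alpha)$ of $b$-bounded bigroup homomorphisms $X\times X\to X$ converges uniformly on bounded sets to a bigroup homomorphism $\sigma:X\times X\to X$. Then $\sigma$ is also $b$-bounded.
   Context: A topological module $X$ over a topological ring $R$ is an $R$-module with a topology making $X$ a topological additive group and making the multiplication $R\times X\to X$ (jointly) continuous. A zero neighborhood is a neighborhood of $0$. A set $B\subseteq X$ is bounded if for each zero neighborhood $W\subseteq X$ there is a zero neighborhood $V\subseteq R$ such that $VB\subseteq W$, where $VB=\{vb: v\in V, b\in B\}$. A bigroup homomorphism $\sigma:X\times X\to X$ is a map that is a homomorphism of additive groups in each variable separately. For $A,B\subseteq X$, $\sigma(A,B)=\{\sigma(a,b):a\in A,b\in B\}$. $\sigma$ is $b$-bounded if for all bounded sets $B_1,B_2\subseteq X$, $\sigma(B_1,B_2)$ is bounded in $X$. A net $(\sigma_\alpha)$ of bigroup homomorphisms converges to $\sigma$ uniformly on bounded sets if for all bounded sets $B_1,B_2\subseteq X$ and each zero neighborhood $W\subseteq X$ there is an $\alpha_0$ with $(\sigma_\alpha-\sigma)(B_1,B_2)\subseteq W$ for all $\alpha\ge\alpha_0$. *)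

theory Defs
  imports Complex_Main
begin

(* No unit is required of the ring, so unital rings with unital modules are a special case.
   No separation axiom is assumed. *)
class topological_ring = ring + topological_ab_group_add + topological_semigroup_mult

(* The library locale module is restricted to commutative rings with 1, hence a new locale. *)
locale topological_module =
  fixes scale :: "'r::topological_ring \<Rightarrow> 'x::topological_ab_group_add \<Rightarrow> 'x"  (infixr \<open>\<cdot>\<close> 75)
  assumes scale_right_distrib: "a \<cdot> (x + y) = a \<cdot> x + a \<cdot> y"
    and scale_left_distrib: "(a + b) \<cdot> x = a \<cdot> x + b \<cdot> x"
    and scale_scale: "a \<cdot> (b \<cdot> x) = (a * b) \<cdot> x"
    and continuous_scale: "continuous_on UNIV (\<lambda>(a, x). a \<cdot> x)"

(* Neighborhoods need not be open. *)
definition zero_neighborhood :: "'a::{topological_space, zero} set \<Rightarrow> bool" where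
  "zero_neighborhood W \<longleftrightarrow> (\<exists>U. open U \<and> 0 \<in> U \<and> U \<subseteq> W)"

definition image_pair :: "('a \<Rightarrow> 'b \<Rightarrow> 'c) \<Rightarrow> 'a set \<Rightarrow> 'b set \<Rightarrow> 'c set" where
  "image_pair f A B = {f a b | a b. a \<in> A \<and> b \<in> B}"

definition module_bounded ::
    "('r::topological_ring \<Rightarrow> 'x::topological_ab_group_add \<Rightarrow> 'x) \<Rightarrow> 'x set \<Rightarrow> bool" where
  "module_bounded scale B \<longleftrightarrow>
    (\<forall>W. zero_neighborhood W \<longrightarrow> (\<exists>V. zero_neighborhood V \<and> image_pair scale V B \<subseteq> W))"

definition bigroup_hom :: "('x::ab_group_add \<Rightarrow> 'x \<Rightarrow> 'x) \<Rightarrow> bool" where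
  "bigroup_hom \<sigma> \<longleftrightarrow>
    (\<forall>x. additive (\<lambda>y. \<sigma> x y)) \<and> (\<forall>y. additive (\<lambda>x. \<sigma> x y))"

definition b_bounded ::
    "('r::topological_ring \<Rightarrow> 'x::topological_ab_group_add \<Rightarrow> 'x) \<Rightarrow> ('x \<Rightarrow> 'x \<Rightarrow> 'x) \<Rightarrow> bool" where
  "b_bounded scale \<sigma> \<longleftrightarrow>
    (\<forall>B1 B2. module_bounded scale B1 \<and> module_bounded scale B2
      \<longrightarrow> module_bounded scale (image_pair \<sigma> B1 B2))"

definition converges_uniformly_on_bounded ::
    "('r::topological_ring \<Rightarrow> 'x::topological_ab_group_add \<Rightarrow> 'x)
      \<Rightarrow> ('i::preorder \<Rightarrow> 'x \<Rightarrow> 'x \<Rightarrow> 'x) \<Rightarrow> ('x \<Rightarrow> 'x \<Rightarrow> 'x) \<Rightarrow> bool" where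
  "converges_uniformly_on_bounded scale \<sigma>s \<sigma> \<longleftrightarrow>
    (\<forall>B1 B2 W. module_bounded scale B1 \<and> module_bounded scale B2 \<and> zero_neighborhood W
      \<longrightarrow> (\<exists>\<alpha>\<^sub>0. \<forall>\<alpha>\<ge>\<alpha>\<^sub>0. image_pair (\<lambda>x y. \<sigma>s \<alpha> x y - \<sigma> x y) B1 B2 \<subseteq> W))"

end

theory Submission
  imports Defs
begin

text \<open>
  The bounded sets are closed under uniform approximation: if for every zero neighborhood
  \<open>U\<close> the set \<open>B\<close> lies within \<open>U\<close> of some bounded set, then \<open>B\<close> is bounded
  (\<open>module_bounded_approx\<close>). Indeed a small scalar \<open>v\<close> makes both parts of
  \<open>v b = v c - v (c - b)\<close> small: the first because \<open>c\<close> runs through a bounded set, the second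
  because multiplication is jointly continuous at \<open>(0, 0)\<close>, so that a single \<open>U\<close> is absorbed
  by a neighborhood of scalars. Uniform convergence on \<open>B\<^sub>1 \<times> B\<^sub>2\<close> says precisely that
  \<open>\<sigma>(B\<^sub>1, B\<^sub>2)\<close> is approximated in this sense by the bounded sets \<open>\<sigma>\<^sub>\<alpha>(B\<^sub>1, B\<^sub>2)\<close>.
\<close>

context topological_module
begin

lemma scale_right_diff_distrib: "a \<cdot> (x - y) = a \<cdot> x - a \<cdot> y"
  using scale_right_distrib[of a "x - y" y] by (simp add: eq_diff_eq)

lemma scale_zero_right: "a \<cdot> 0 = 0"
  using scale_right_diff_distrib[of a 0 0] by simp

text \<open>
  Zero neighborhoods need not be bounded, so the zero neighborhood of vectors has to be chosen
  together with that of scalars.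
\<close>
lemma scale_zero_neighborhoods:
  assumes "zero_neighborhood W"
  obtains V U where "zero_neighborhood V" "zero_neighborhood U" "image_pair scale V U \<subseteq> W"
proof -
  obtain W' where W': "open W'" "0 \<in> W'" "W' \<subseteq> W"
    using assms unfolding zero_neighborhood_def by blast
  have "open ((\<lambda>(a, x). a \<cdot> x) -` W')"
    using continuous_scale W'(1) by (simp add: continuous_on_open_vimage)
  moreover have "(0, 0) \<in> (\<lambda>(a, x). a \<cdot> x) -` W'"
    using W'(2) by (simp add: scale_zero_right)
  ultimately obtain V U where "open V" "open U" "(0, 0) \<in> V \<times> U"
      "V \<times> U \<subseteq> (\<lambda>(a, x). a \<cdot> x) -` W'"
    by (rule open_prod_elim)
  then show thesis
    using W'(3) by (intro that[of V U]) (auto simp: zero_neighborhood_def image_pair_def)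
qed

end

lemma zero_neighborhood_diff:
  fixes W :: "'x::topological_ab_group_add set"
  assumes "zero_neighborhood W"
  obtains A B where "zero_neighborhood A" "zero_neighborhood B" "image_pair (-) A B \<subseteq> W"
proof -
  obtain W' where W': "open W'" "0 \<in> W'" "W' \<subseteq> W"
    using assms unfolding zero_neighborhood_def by blast
  have "continuous_on UNIV (\<lambda>p::'x \<times> 'x. fst p - snd p)"
    by (intro continuous_intros)
  then have "open ((\<lambda>p. fst p - snd p) -` W')"
    using W'(1) by (simp add: continuous_on_open_vimage)
  moreover have "(0, 0) \<in> (\<lambda>p. fst p - snd p) -` W'"
    using W'(2) by simp
  ultimately obtain A B where "open A" "open B" "(0, 0) \<in> A \<times> B"
      "A \<times> B \<subseteq> (\<lambda>p. fst p - snd p) -` W'"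
    by (rule open_prod_elim)
  then show thesis
    using W'(3)
    by (intro that[of A B]) (fastforce simp: zero_neighborhood_def image_pair_def)+
qed

lemma zero_neighborhood_Int:
  assumes "zero_neighborhood A" "zero_neighborhood B"
  shows "zero_neighborhood (A \<inter> B)"
proof -
  obtain U V where "open U" "0 \<in> U" "U \<subseteq> A" "open V" "0 \<in> V" "V \<subseteq> B"
    using assms unfolding zero_neighborhood_def by blast
  then show ?thesis
    unfolding zero_neighborhood_def by (intro exI[of _ "U \<inter> V"]) auto
qed

text \<open>
  The bounded set \<open>C\<close> may depend on \<open>U\<close>. This is harmless because \<open>U\<close> is determined by the
  target neighborhood alone, before \<open>C\<close> and the scalars absorbing it are chosen.
\<close>
lemma (in topological_module) module_bounded_approx:
  assumes approx: "\<And>U. zero_neighborhood U \<Longrightarrow>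
    \<exists>C. module_bounded scale C \<and> (\<forall>b\<in>B. \<exists>c\<in>C. c - b \<in> U)"
  shows "module_bounded scale B"
  unfolding module_bounded_def
proof (intro allI impI)
  fix W :: "'x set"
  assume "zero_neighborhood W"
  then obtain W1 W2 where W: "zero_neighborhood W1" "zero_neighborhood W2"
      "image_pair (-) W1 W2 \<subseteq> W"
    by (rule zero_neighborhood_diff)
  obtain V2 U where V2: "zero_neighborhood V2" "zero_neighborhood U"
      "image_pair scale V2 U \<subseteq> W2"
    using W(2) by (rule scale_zero_neighborhoods)
  obtain C where C: "module_bounded scale C" "\<forall>b\<in>B. \<exists>c\<in>C. c - b \<in> U"
    using approx[OF V2(2)] by blast
  obtain V1 where V1: "zero_neighborhood V1" "image_pair scale V1 C \<subseteq> W1"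
    using C(1) W(1) unfolding module_bounded_def by blast
  have "v \<cdot> b \<in> W" if "v \<in> V1 \<inter> V2" "b \<in> B" for v b
  proof -
    obtain c where c: "c \<in> C" "c - b \<in> U"
      using C(2) \<open>b \<in> B\<close> by blast
    have "v \<cdot> c \<in> W1" "v \<cdot> (c - b) \<in> W2"
      using V1(2) V2(3) c that(1) by (auto simp: image_pair_def)
    then have "v \<cdot> c - v \<cdot> (c - b) \<in> W"
      using W(3) by (auto simp: image_pair_def)
    then show ?thesis
      by (simp add: scale_right_diff_distrib)
  qed
  then have "image_pair scale (V1 \<inter> V2) B \<subseteq> W"
    by (auto simp: image_pair_def)
  with zero_neighborhood_Int[OF V1(1) V2(1)]
  show "\<exists>V. zero_neighborhood V \<and> image_pair scale V B \<subseteq> W"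
    by blast
qed

theorem proposition11:
  fixes scale :: "'r::topological_ring \<Rightarrow> 'x::topological_ab_group_add \<Rightarrow> 'x"
    and \<sigma>s :: "'i::preorder \<Rightarrow> 'x \<Rightarrow> 'x \<Rightarrow> 'x"
    and \<sigma> :: "'x \<Rightarrow> 'x \<Rightarrow> 'x"
  assumes "topological_module scale"
    and directed: "\<And>\<alpha> \<beta> :: 'i. \<exists>\<gamma>. \<alpha> \<le> \<gamma> \<and> \<beta> \<le> \<gamma>"
    and "\<And>\<alpha>. bigroup_hom (\<sigma>s \<alpha>)"
    and "\<And>\<alpha>. b_bounded scale (\<sigma>s \<alpha>)"
    and "bigroup_hom \<sigma>"
    and "converges_uniformly_on_bounded scale \<sigma>s \<sigma>"
  shows "b_bounded scale \<sigma>"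
  unfolding b_bounded_def
proof (intro allI impI)
  fix B1 B2
  assume B: "module_bounded scale B1 \<and> module_bounded scale B2"
  show "module_bounded scale (image_pair \<sigma> B1 B2)"
  proof (rule topological_module.module_bounded_approx[OF assms(1)])
    fix U :: "'x set"
    assume "zero_neighborhood U"
    then obtain \<alpha> where "image_pair (\<lambda>x y. \<sigma>s \<alpha> x y - \<sigma> x y) B1 B2 \<subseteq> U"
      using assms(6) B unfolding converges_uniformly_on_bounded_def by blast
    then have "\<forall>b\<in>image_pair \<sigma> B1 B2. \<exists>c\<in>image_pair (\<sigma>s \<alpha>) B1 B2. c - b \<in> U"
      unfolding image_pair_def by blast
    moreover have "module_bounded scale (image_pair (\<sigma>s \<alpha>) B1 B2)"
      using assms(4)[of \<alpha>] B unfolding b_bounded_def by blast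
    ultimately show "\<exists>C. module_bounded scale C \<and>
        (\<forall>b\<in>image_pair \<sigma> B1 B2. \<exists>c\<in>C. c - b \<in> U)"
      by blast
  qed
qed

end
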